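(* Let $P_n$ be the path on $n$ vertices, where $n\ge 3$. Then $$b_{\rm R}(P_n)=\begin{cases}1, & \text{if } n\equiv 0,1 \pmod 3;\\ 2, & \text{otherwise.}\end{cases}$$
   Context: Graphs are finite, undirected, without loops or multiple edges; a graph is nonempty if it has at least one edge. A Roman dominating function on $G=(V,E)$ is a function $f:V\to\{0,1,2\}$ such that every vertex $x$ with $f(x)=0$ is adjacent to at least one vertex $y$ with $f(y)=2$. Its weight is $\sum_{u\in V}f(u)$. The Roman domination number $\gamma_{\rm R}(G)$ is the minimum weight of a Roman dominating function on $G$. The Roman bondage number of a nonempty graph $G$ is $b_{\rm R}(G)=\min\{|B|: B\subseteq E(G),\ \gamma_{\rm R}(G-B)>\gamma_{\rm R}(G)\}$, with $b_{\rm R}(G)=\infty$ if no such $B$ exists; here $G-B$ is obtained from $G$ by deleting the edges in $B$ (keeping all vertices). *)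

theory Defs
  imports Main "HOL-Library.Extended_Nat"
begin

record 'a graph =
  verts :: "'a set"
  edges :: "'a set set"

definition simple_graph :: "'a graph \<Rightarrow> bool" where
  "simple_graph G \<longleftrightarrow>
     finite (verts G) \<and> (\<forall>e\<in>edges G. e \<subseteq> verts G \<and> card e = 2)"

definition delete_edges :: "'a graph \<Rightarrow> 'a set set \<Rightarrow> 'a graph" where
  "delete_edges G B = \<lparr>verts = verts G, edges = edges G - B\<rparr>"

text \<open>Functions on the vertex set are total functions on the vertex type; only their
  values on the vertices enter the definitions.\<close>

definition roman_dominating :: "'a graph \<Rightarrow> ('a \<Rightarrow> nat) \<Rightarrow> bool" where
  "roman_dominating G f \<longleftrightarrow>
     f ` verts G \<subseteq> {0, 1, 2} \<and>
     (\<forall>x\<in>verts G. f x = 0 \<longrightarrow> (\<exists>y\<in>verts G. {x, y} \<in> edges G \<and> f y = 2))"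

definition weight :: "'a graph \<Rightarrow> ('a \<Rightarrow> nat) \<Rightarrow> nat" where
  "weight G f = (\<Sum>u\<in>verts G. f u)"

text \<open>The infimum in the natural numbers is a minimum, since the constant function 1 is
  always Roman dominating.\<close>

definition roman_domination_number :: "'a graph \<Rightarrow> nat" where
  "roman_domination_number G = Inf {weight G f | f. roman_dominating G f}"

text \<open>In the extended naturals the infimum of the empty set is \<open>\<infinity>\<close>, and that of a
  nonempty set is attained.\<close>

definition roman_bondage_number :: "'a graph \<Rightarrow> enat" where
  "roman_bondage_number G =
     Inf {enat (card B) | B. B \<subseteq> edges G \<and>
       roman_domination_number (delete_edges G B) > roman_domination_number G}"

definition path_graph :: "nat \<Rightarrow> nat graph" where
  "path_graph n = \<lparr>verts = {0..<n}, edges = {{i, Suc i} | i. Suc i < n}\<rparr>"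

lemma simple_graph_path_graph: "simple_graph (path_graph n)"
  by (auto simp: simple_graph_def path_graph_def)

lemma simple_graph_delete_edges: "simple_graph G \<Longrightarrow> simple_graph (delete_edges G B)"
  by (auto simp: simple_graph_def delete_edges_def)

lemma path_graph_nonempty: "n \<ge> 2 \<Longrightarrow> edges (path_graph n) \<noteq> {}"
  by (auto simp: path_graph_def intro!: exI[of _ 0])

lemma roman_domination_number_attained:
  "\<exists>f. roman_dominating G f \<and> weight G f = roman_domination_number G"
proof -
  have "roman_dominating G (\<lambda>_. 1)"
    by (auto simp: roman_dominating_def)
  then have "{weight G f | f. roman_dominating G f} \<noteq> {}"
    by blast
  from Inf_nat_def1[OF this] show ?thesis
    by (auto simp: roman_domination_number_def)
qed

end

theory Submission
  imports Defs
begin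

text \<open>
  The path on \<open>k\<close> vertices has Roman domination number \<open>\<lceil>2k/3\<rceil>\<close>. It cannot be less:
  in a graph of maximum degree 2 a vertex of value 2 takes care of at most three vertices (itself
  and two neighbours) and a vertex of value 1 only of itself, so no unit of weight serves more
  than \<open>3/2\<close> vertices (\<open>weight_bounded_degree\<close>). It need not be more: the pattern
  \<open>0 2 0 0 2 0 \<dots>\<close>, with a final 1 when \<open>k \<equiv> 1\<close> modulo 3, attains the bound.

  Deleting edges cuts the path into shorter paths, so the question is how the total of the rounded
  numbers changes when \<open>n\<close> is split into parts. They are best written as
  \<open>\<lceil>2k/3\<rceil> = 2 (k div 3) + k mod 3\<close>. When the parts are added up to \<open>n\<close>, this
  expression is additive as long as the residues add up without a carry, while each carry
  replaces three units of residue by a quotient unit worth two. The total therefore exceeds the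
  value of the whole path by the number of carries. If \<open>n \<equiv> 0\<close> or \<open>n \<equiv> 1\<close>, one cut can produce a carry, as in
  \<open>3m = 1 + (3m - 1)\<close> and \<open>3m + 1 = 2 + (3m - 1)\<close>. If \<open>n \<equiv> 2\<close>, the residues of two
  parts add up to 2 and never to 5, so one edge is never enough
  (\<open>path_cost_split\<close>, \<open>roman_domination_number_path_cut_le\<close>); but the three
  parts \<open>3m + 2 = 2 + 1 + (3m - 1)\<close> have residue sum 5, and two edges are.
\<close>

section \<open>Weight forced by bounded degree\<close>

text \<open>
  Since \<open>W\<close> is a union of components, every vertex of value 0 in \<open>W\<close> is a neighbour of a
  vertex of value 2 that lies in \<open>W\<close> as well. There are thus at most \<open>d\<close> vertices of
  value 0 per vertex of value 2. The bound \<open>1 \<le> d\<close> makes \<open>d + 1\<close> at least 2, the price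
  at which the vertices of value 1 are counted.
\<close>

lemma weight_bounded_degree:
  assumes f: "roman_dominating G f"
    and W: "W \<subseteq> verts G" "finite W"
    and closed: "\<And>x y. x \<in> W \<Longrightarrow> y \<in> verts G \<Longrightarrow> {x, y} \<in> edges G \<Longrightarrow> y \<in> W"
    and degree: "\<And>y. y \<in> W \<Longrightarrow> card {x \<in> W. {x, y} \<in> edges G} \<le> d"
    and d: "1 \<le> d"
  shows "2 * card W \<le> (d + 1) * sum f W"
proof -
  define V where "V i = {x \<in> W. f x = i}" for i
  have fin: "finite (V i)" for i
    using W(2) by (simp add: V_def)
  have disj: "V i \<inter> V j = {}" if "i \<noteq> j" for i j
    using that by (auto simp: V_def)
  have W_eq: "W = V 0 \<union> V 1 \<union> V 2"
    using f W(1) by (auto simp: V_def roman_dominating_def image_subset_iff)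
  have card_W: "card W = card (V 0) + card (V 1) + card (V 2)"
    by (subst W_eq) (simp add: card_Un_disjoint fin disj Int_Un_distrib2)
  have "sum f W = sum f (V 0) + sum f (V 1) + sum f (V 2)"
    by (subst W_eq) (simp add: sum.union_disjoint fin disj Int_Un_distrib2)
  moreover have "sum f (V i) = card (V i) * i" for i
    by (simp add: V_def)
  ultimately have sum_W: "sum f W = card (V 1) + 2 * card (V 2)"
    by simp
  have "V 0 \<subseteq> (\<Union>y\<in>V 2. {x \<in> W. {x, y} \<in> edges G})"
  proof
    fix x assume "x \<in> V 0"
    then have x: "x \<in> W" "f x = 0"
      by (auto simp: V_def)
    with f W(1) obtain y where y: "y \<in> verts G" "{x, y} \<in> edges G" "f y = 2"
      unfolding roman_dominating_def by blast
    with closed x have "y \<in> V 2"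
      by (auto simp: V_def)
    with x y show "x \<in> (\<Union>y\<in>V 2. {x \<in> W. {x, y} \<in> edges G})"
      by auto
  qed
  then have "card (V 0) \<le> card (\<Union>y\<in>V 2. {x \<in> W. {x, y} \<in> edges G})"
    using W(2) fin by (intro card_mono) auto
  also have "\<dots> \<le> (\<Sum>y\<in>V 2. card {x \<in> W. {x, y} \<in> edges G})"
    using fin by (rule card_UN_le)
  also have "\<dots> \<le> (\<Sum>y\<in>V 2. d)"
    using degree by (intro sum_mono) (auto simp: V_def)
  finally have "card (V 0) \<le> card (V 2) * d"
    by simp
  moreover have "2 * card (V 1) \<le> (d + 1) * card (V 1)"
    using d by (intro mult_right_mono) auto
  ultimately show ?thesis
    unfolding card_W sum_W by (simp only: algebra_simps)
qed

section \<open>Two thirds, rounded up\<close>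

text \<open>
  The expression is the least integer not below \<open>2k/3\<close>: three times it is \<open>2k + k mod 3\<close>, less
  than 3 above \<open>2k\<close>.
\<close>

lemma path_cost_le:
  fixes k s :: nat
  assumes "2 * k \<le> 3 * s"
  shows "2 * (k div 3) + k mod 3 \<le> s"
proof -
  have "k mod 3 < 3"
    by simp
  with assms mult_div_mod_eq[of 3 k] show ?thesis
    by linarith
qed

text \<open>
  Two residues modulo 3 add up to at most 4, so a sum congruent to 2 is 2 itself: the addition
  has no carry.
\<close>

lemma path_cost_split:
  fixes a b :: nat
  assumes "(a + b) mod 3 = 2"
  shows "2 * (a div 3) + a mod 3 + (2 * (b div 3) + b mod 3)
           = 2 * ((a + b) div 3) + (a + b) mod 3"
proof -
  have "a mod 3 + b mod 3 = 2"
  proof -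
    have "a mod 3 \<in> {0, 1, 2}" "b mod 3 \<in> {0, 1, 2}"
      by auto
    moreover have "(a mod 3 + b mod 3) mod 3 = 2"
      using assms by (simp add: mod_add_eq)
    ultimately show ?thesis
      by auto
  qed
  with assms show ?thesis
    by (simp add: div_add1_eq[of a b 3])
qed

section \<open>Paths with deleted edges\<close>

lemma weight_cut_path:
  "weight (delete_edges (path_graph n) B) f = sum f {0..<n}"
  by (simp add: weight_def delete_edges_def path_graph_def)

lemma edges_cut_path_iff:
  "{x, y} \<in> edges (delete_edges (path_graph n) B) \<longleftrightarrow>
     (y = Suc x \<and> y < n \<or> x = Suc y \<and> x < n) \<and> {x, y} \<notin> B"
  by (auto simp: delete_edges_def path_graph_def doubleton_eq_iff)

text \<open>
  A segment whose two ends are ends of the path or cuts has no edges to the rest of the path, so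
  it must carry the weight of a path of its own length, whatever else is deleted.
\<close>

lemma weight_path_segment:
  assumes f: "roman_dominating (delete_edges (path_graph n) B) f"
    and ab: "a < b" "b \<le> n"
    and left: "a = 0 \<or> {a - 1, a} \<in> B"
    and right: "b = n \<or> {b - 1, b} \<in> B"
  shows "2 * ((b - a) div 3) + (b - a) mod 3 \<le> sum f {a..<b}"
proof -
  let ?G = "delete_edges (path_graph n) B"
  have "2 * card {a..<b} \<le> (2 + 1) * sum f {a..<b}"
  proof (rule weight_bounded_degree[OF f])
    show "{a..<b} \<subseteq> verts ?G"
      using ab by (auto simp: delete_edges_def path_graph_def)
    show "y \<in> {a..<b}" if "x \<in> {a..<b}" "y \<in> verts ?G" "{x, y} \<in> edges ?G" for x y
    proof (rule ccontr)
      assume "y \<notin> {a..<b}"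
      \<comment> \<open>An edge that leaves the segment is one of the two edges at its ends.\<close>
      with that have "a \<noteq> 0 \<and> {x, y} = {a - 1, a} \<or> b \<noteq> n \<and> {x, y} = {b - 1, b}"
        by (auto simp: edges_cut_path_iff doubleton_eq_iff)
      with left right have "{x, y} \<in> B"
        by metis
      with that(3) show False
        by (simp add: edges_cut_path_iff)
    qed
    show "card {x \<in> {a..<b}. {x, y} \<in> edges ?G} \<le> 2" for y
    proof -
      have "{x \<in> {a..<b}. {x, y} \<in> edges ?G} \<subseteq> {y - 1, Suc y}"
        by (auto simp: edges_cut_path_iff)
      then have "card {x \<in> {a..<b}. {x, y} \<in> edges ?G} \<le> card {y - 1, Suc y}"
        by (intro card_mono) auto
      also have "\<dots> \<le> 2"
        by (simp add: card_insert_if)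
      finally show ?thesis .
    qed
  qed auto
  then show ?thesis
    by (intro path_cost_le) simp
qed

section \<open>Optimal functions on paths\<close>

text \<open>
  The values 2 stand at positions congruent to 1, where each of them serves a block of three
  vertices. Only a last vertex at a position congruent to 0 is left over by the blocks.
\<close>

definition roman_pattern :: "nat \<Rightarrow> nat \<Rightarrow> nat" where
  "roman_pattern k i =
     (if i mod 3 = 1 then 2 else if i mod 3 = 0 \<and> Suc i = k then 1 else 0)"

lemma roman_pattern_neighbour:
  assumes "i < k" "roman_pattern k i = 0"
  shows "\<exists>j<k. (j = Suc i \<or> i = Suc j) \<and> roman_pattern k j = 2"
proof (cases "i mod 3 = 0")
  case True
  with assms show ?thesis
    by (intro exI[of _ "Suc i"]) (auto simp: roman_pattern_def mod_Suc split: if_splits)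
next
  case False
  with assms(2) have *: "i mod 3 = 2"
    by (auto simp: roman_pattern_def split: if_splits)
  show ?thesis
  proof (cases i)
    case (Suc j)
    with * have "j mod 3 = 1" by (auto simp: mod_Suc split: if_splits)
    with Suc assms(1) show ?thesis
      by (intro exI[of _ j]) (auto simp: roman_pattern_def)
  qed (use * in simp)
qed

lemma sum_roman_pattern: "(\<Sum>i=0..<k. roman_pattern k i) = 2 * (k div 3) + k mod 3"
proof (cases k)
  case (Suc m)
  \<comment> \<open>An unfinished block already contains its value 2 once it has two positions.\<close>
  have twos: "(\<Sum>i=0..<j. if i mod 3 = 1 then 2 else 0)
                = 2 * (j div 3) + (if j mod 3 = 2 then 2 else 0)" for j :: nat
    by (induction j) (auto simp: mod_Suc div_Suc)
  have "(\<Sum>i=0..<m. roman_pattern k i) = (\<Sum>i=0..<m. if i mod 3 = 1 then 2 else 0)"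
    using Suc by (intro sum.cong) (auto simp: roman_pattern_def)
  then have "(\<Sum>i=0..<k. roman_pattern k i)
               = 2 * (m div 3) + (if m mod 3 = 2 then 2 else 0) + roman_pattern k m"
    using Suc twos by simp
  also have "\<dots> = 2 * (k div 3) + k mod 3"
  proof -
    have "m mod 3 \<in> {0, 1, 2}"
      by auto
    then show ?thesis
      using Suc by (auto simp: roman_pattern_def mod_Suc div_Suc)
  qed
  finally show ?thesis .
qed simp

section \<open>Cutting a path in at most one place\<close>

lemma roman_domination_number_le:
  "roman_dominating G f \<Longrightarrow> roman_domination_number G \<le> weight G f"
  unfolding roman_domination_number_def by (rule wellorder_Inf_le1) blast

text \<open>
  Each of the two sides of the cut gets its own pattern, so the edge between them is not used.
  For \<open>B = {}\<close> and a cut behind the last vertex this bounds the uncut path.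
\<close>

lemma roman_domination_number_path_cut_le:
  assumes k: "k < n" and B: "B \<subseteq> {{k, Suc k}}"
  shows "roman_domination_number (delete_edges (path_graph n) B)
           \<le> 2 * (Suc k div 3) + Suc k mod 3 + (2 * ((n - Suc k) div 3) + (n - Suc k) mod 3)"
proof -
  let ?G = "delete_edges (path_graph n) B"
  let ?a = "Suc k"
  define f where "f v = (if v < ?a then roman_pattern ?a v else roman_pattern (n - ?a) (v - ?a))" for v
  have "roman_dominating ?G f"
    unfolding roman_dominating_def
  proof (intro conjI ballI impI)
    show "f ` verts ?G \<subseteq> {0, 1, 2}"
      by (auto simp: f_def roman_pattern_def)
    fix x assume "x \<in> verts ?G" and fx: "f x = 0"
    then have x: "x < n"
      by (simp add: delete_edges_def path_graph_def)
    have "\<exists>y<n. (y = Suc x \<or> x = Suc y) \<and> {x, y} \<noteq> {k, Suc k} \<and> f y = 2"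
    proof (cases "x < ?a")
      case True
      with fx obtain j where "j < ?a" "j = Suc x \<or> x = Suc j" "roman_pattern ?a j = 2"
        using roman_pattern_neighbour[of x ?a] by (auto simp: f_def)
      with True k show ?thesis
        by (intro exI[of _ j]) (auto simp: f_def doubleton_eq_iff)
    next
      case False
      with fx x have "x - ?a < n - ?a" "roman_pattern (n - ?a) (x - ?a) = 0"
        by (auto simp: f_def)
      then obtain j where "j < n - ?a" "j = Suc (x - ?a) \<or> x - ?a = Suc j"
          "roman_pattern (n - ?a) j = 2"
        using roman_pattern_neighbour by blast
      with False show ?thesis
        by (intro exI[of _ "?a + j"]) (auto simp: f_def doubleton_eq_iff)
    qed
    then obtain y where y: "y < n" "y = Suc x \<or> x = Suc y" "{x, y} \<noteq> {k, Suc k}" "f y = 2"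
      by blast
    with x B have "{x, y} \<in> edges ?G"
      unfolding edges_cut_path_iff by blast
    moreover have "y \<in> verts ?G"
      using y by (simp add: delete_edges_def path_graph_def)
    ultimately show "\<exists>y\<in>verts ?G. {x, y} \<in> edges ?G \<and> f y = 2"
      using y by blast
  qed
  then have "roman_domination_number ?G \<le> sum f {0..<n}"
    using roman_domination_number_le weight_cut_path by metis
  also have "sum f {0..<n} = sum f {0..<?a} + sum f {?a..<n}"
    using k by (intro sum.atLeastLessThan_concat[symmetric]) auto
  also have "sum f {0..<?a} = (\<Sum>i=0..<?a. roman_pattern ?a i)"
    by (intro sum.cong) (auto simp: f_def)
  also have "sum f {?a..<n} = (\<Sum>i=0..<n - ?a. roman_pattern (n - ?a) i)"
    by (rule sum.reindex_bij_witness[of _ "\<lambda>i. i + ?a" "\<lambda>v. v - ?a"]) (auto simp: f_def)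
  finally show ?thesis
    by (simp only: sum_roman_pattern)
qed

lemma delete_no_edges: "delete_edges G {} = G"
  by (simp add: delete_edges_def)

lemma roman_domination_number_path:
  assumes "n \<ge> 1"
  shows "roman_domination_number (path_graph n) = 2 * (n div 3) + n mod 3"
proof (rule antisym)
  show "roman_domination_number (path_graph n) \<le> 2 * (n div 3) + n mod 3"
    using roman_domination_number_path_cut_le[of "n - 1" n "{}"] assms
    by (simp add: delete_no_edges)
  obtain f where f: "roman_dominating (path_graph n) f"
      "weight (path_graph n) f = roman_domination_number (path_graph n)"
    using roman_domination_number_attained by blast
  then show "2 * (n div 3) + n mod 3 \<le> roman_domination_number (path_graph n)"
    using weight_path_segment[of n "{}" f 0 n] weight_cut_path[of n "{}" f] assms
    by (simp add: delete_no_edges)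
qed

section \<open>The Roman bondage number\<close>

lemma roman_bondage_number_path_le:
  assumes B: "B \<subseteq> edges (path_graph n)" and "n \<ge> 1"
    and heavy: "\<And>f. roman_dominating (delete_edges (path_graph n) B) f \<Longrightarrow>
                  2 * (n div 3) + n mod 3 < sum f {0..<n}"
  shows "roman_bondage_number (path_graph n) \<le> enat (card B)"
proof -
  obtain f where "roman_dominating (delete_edges (path_graph n) B) f"
      "weight (delete_edges (path_graph n) B) f
         = roman_domination_number (delete_edges (path_graph n) B)"
    using roman_domination_number_attained by blast
  with heavy[of f] roman_domination_number_path[of n] \<open>n \<ge> 1\<close>
  have "roman_domination_number (path_graph n)
          < roman_domination_number (delete_edges (path_graph n) B)"
    by (simp add: weight_cut_path)
  with B show ?thesis
    unfolding roman_bondage_number_def by (intro Inf_lower) blast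
qed

lemma roman_bondage_number_ge:
  assumes "\<And>B. B \<subseteq> edges G \<Longrightarrow> card B < d \<Longrightarrow>
           roman_domination_number (delete_edges G B) \<le> roman_domination_number G"
  shows "enat d \<le> roman_bondage_number G"
  unfolding roman_bondage_number_def
proof (rule Inf_greatest, clarify)
  fix B
  assume "B \<subseteq> edges G"
    and "roman_domination_number G < roman_domination_number (delete_edges G B)"
  with assms[of B] show "enat d \<le> enat (card B)"
    by (metis enat_ord_simps(1) not_le)
qed

lemma finite_edges_path: "finite (edges (path_graph n))"
proof -
  have "edges (path_graph n) \<subseteq> Pow {0..<n}"
    by (auto simp: path_graph_def)
  then show ?thesis
    by (rule finite_subset) simp
qed

theorem theorem3p1:
  fixes n :: nat
  assumes "n \<ge> 3"
  shows "roman_bondage_number (path_graph n) =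
           (if n mod 3 = 0 \<or> n mod 3 = 1 then 1 else 2)"
proof (cases "n mod 3 = 2")
  case False
  \<comment> \<open>Cut off a first piece that leaves residue 2 for the second, so that there is a carry.\<close>
  define k where "k = (if n mod 3 = 0 then 1 else 2 :: nat)"
  define m where "m = n div 3 - 1"
  have r: "n mod 3 = 0 \<or> n mod 3 = 1"
    using False by auto
  have "n div 3 = m + 1"
    using assms div_le_mono[of 3 n 3] by (simp add: m_def)
  with r mult_div_mod_eq[of 3 n] have n: "n = k + (3 * m + 2)"
    by (auto simp: k_def)
  have k: "k = 1 \<or> k = 2"
    by (simp add: k_def)
  define B where "B = {{k - 1, k}}"
  have "roman_bondage_number (path_graph n) \<le> enat (card B)"
  proof (rule roman_bondage_number_path_le)
    show "B \<subseteq> edges (path_graph n)"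
      using k n by (auto simp: B_def path_graph_def intro!: exI[of _ "k - 1"])
    fix f assume f: "roman_dominating (delete_edges (path_graph n) B) f"
    have "2 * (k div 3) + k mod 3 \<le> sum f {0..<k}"
         "2 * ((n - k) div 3) + (n - k) mod 3 \<le> sum f {k..<n}"
      using weight_path_segment[OF f, of 0 k] weight_path_segment[OF f, of k n] k n
      by (auto simp: B_def)
    moreover have "sum f {0..<n} = sum f {0..<k} + sum f {k..<n}"
      using n by (intro sum.atLeastLessThan_concat[symmetric]) auto
    ultimately show "2 * (n div 3) + n mod 3 < sum f {0..<n}"
      using k n by (auto simp: div_Suc mod_Suc)
  qed (use assms in simp)
  moreover have "enat 1 \<le> roman_bondage_number (path_graph n)"
  proof (rule roman_bondage_number_ge)
    fix B assume "B \<subseteq> edges (path_graph n)" "card B < 1"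
    then have "B = {}"
      using finite_edges_path finite_subset by fastforce
    then show "roman_domination_number (delete_edges (path_graph n) B)
                 \<le> roman_domination_number (path_graph n)"
      by (simp add: delete_no_edges)
  qed
  ultimately have "roman_bondage_number (path_graph n) = 1"
    by (simp add: B_def one_enat_def)
  with r show ?thesis
    by auto
next
  case True
  define m where "m = n div 3 - 1"
  have "n div 3 = m + 1"
    using assms div_le_mono[of 3 n 3] by (simp add: m_def)
  with True mult_div_mod_eq[of 3 n] have n: "n = 3 * m + 5"
    by simp
  \<comment> \<open>The pieces have 2, 1 and \<open>n - 3\<close> vertices, so their residues add up to 5: one carry.\<close>
  define B where "B = {{1, 2}, {2, 3 :: nat}}"
  have "roman_bondage_number (path_graph n) \<le> enat (card B)"
  proof (rule roman_bondage_number_path_le)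
    show "B \<subseteq> edges (path_graph n)"
      using n by (auto simp: B_def path_graph_def intro: exI[of _ 1] exI[of _ 2])
    fix f assume f: "roman_dominating (delete_edges (path_graph n) B) f"
    have "2 \<le> sum f {0..<2}" "1 \<le> sum f {2..<3}"
         "2 * ((n - 3) div 3) + (n - 3) mod 3 \<le> sum f {3..<n}"
      using weight_path_segment[OF f, of 0 2] weight_path_segment[OF f, of 2 3]
        weight_path_segment[OF f, of 3 n] n
      by (auto simp: B_def)
    moreover have "sum f {0..<n} = sum f {0..<2} + sum f {2..<3} + sum f {3..<n}"
      using sum.atLeastLessThan_concat[of 0 2 3 f] sum.atLeastLessThan_concat[of 0 3 n f] n
      by linarith
    ultimately show "2 * (n div 3) + n mod 3 < sum f {0..<n}"
      using n by (simp add: div_Suc mod_Suc)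
  qed (use assms in simp)
  moreover have "card B = 2"
    by (simp add: B_def doubleton_eq_iff)
  moreover have "enat 2 \<le> roman_bondage_number (path_graph n)"
  proof (rule roman_bondage_number_ge)
    fix B assume B: "B \<subseteq> edges (path_graph n)" "card B < 2"
    have "finite B"
      using B(1) finite_edges_path by (rule finite_subset)
    with B(2) have "B = {} \<or> (\<exists>e. B = {e})"
      by (metis One_nat_def card_1_singletonE card_0_eq less_2_cases)
    then obtain k where k: "k < n" "B \<subseteq> {{k, Suc k}}"
    proof
      assume "B = {}"
      with that[of 0] assms show ?thesis
        by simp
    next
      assume "\<exists>e. B = {e}"
      then obtain e where "B = {e}" ..
      moreover from this B(1) obtain k where "e = {k, Suc k}" "Suc k < n"
        by (auto simp: path_graph_def)
      ultimately show ?thesis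
        using that[of k] by simp
    qed
    have "roman_domination_number (delete_edges (path_graph n) B)
            \<le> 2 * (Suc k div 3) + Suc k mod 3 + (2 * ((n - Suc k) div 3) + (n - Suc k) mod 3)"
      using k by (rule roman_domination_number_path_cut_le)
    also have "\<dots> = 2 * (n div 3) + n mod 3"
      using path_cost_split[of "Suc k" "n - Suc k"] k(1) True by simp
    also have "\<dots> = roman_domination_number (path_graph n)"
      using roman_domination_number_path[of n] n by simp
    finally show "roman_domination_number (delete_edges (path_graph n) B)
                    \<le> roman_domination_number (path_graph n)" .
  qed
  ultimately have "roman_bondage_number (path_graph n) = 2"
    by (simp add: numeral_eq_enat)
  with True show ?thesis
    by simp
qed

end
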